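(* Let $1\le r<\infty$ and let $[a,b]$ be a compact interval. If $F\in L^r[a,b]$ is an $ACG_r$-function on $[a,b]$, then $F$ is $L^r$-differentiable at almost every point of $[a,b]$ (with respect to Lebesgue measure).
   Context: Functions are real-valued and defined at every point of $[a,b]$ (so $F\in L^r=L^r[a,b]$ means a function $F\colon[a,b]\to\mathbb R$ that is measurable with $|F|^r$ Lebesgue integrable; pointwise values matter). An interval is a non-degenerate closed subinterval of $[a,b]$. $L^r$-derivative: $F$ is $L^r$-differentiable at $x$ if there is a real number $\alpha$ with $\left(\frac1h\int_{-h}^{h}|F(x+t)-F(x)-\alpha t|^r\,dt\right)^{1/r}=o(h)$ as $h\to0^+$; this $\alpha$ is unique and is denoted $F_r'(x)$. A tagged interval is a pair $(I,x)$ with $I$ an interval and $x\in I$. A partition is a finite collection of tagged intervals whose intervals are pairwise nonoverlapping (no common interior points); it is tagged in $E$ if all tags lie in $E$. A gauge on $E\subset[a,b]$ is a strictly positive function $\delta$ on $E$. A tagged interval $(I,x)$ is $\delta$-fine if $I\subset(x-\delta(x),x+\delta(x))$, and a partition is $\delta$-fine if all its elements are. For $E\subset[a,b]$ and $F\in L^r$, $F\in AC_r(E)$ means: for each $\varepsilon>0$ there exist $\eta>0$ and a gauge $\delta$ on $E$ such that for every $\delta$-fine partition $\{([c_i,d_i],x_i)\}_i$ tagged in $E$ with $\sum_i(d_i-c_i)<\eta$ one has $\sum_i\left(\frac1{d_i-c_i}\int_{c_i}^{d_i}|F(y)-F(x_i)|^r\,dy\right)^{1/r}<\varepsilon$. $F\in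 L^r$ is an $ACG_r$-function if $[a,b]=\bigcup_{n=1}^\infty E_n$ for some sets $E_n$ with $F\in AC_r(E_n)$ for all $n$. *)

theory Defs
  imports "HOL-Analysis.Analysis" "HOL-Library.Landau_Symbols"
begin

text \<open>Functions on \<open>[a,b]\<close> are represented by total functions \<open>real \<Rightarrow> real\<close>; their values
  outside \<open>[a,b]\<close> are junk. Integrals are Lebesgue integrals with respect to the completed measure
  \<open>lebesgue\<close>, so that ``measurable'' means Lebesgue measurable.\<close>

definition in_Lr :: "real \<Rightarrow> real \<Rightarrow> real \<Rightarrow> (real \<Rightarrow> real) \<Rightarrow> bool" where
  "in_Lr r a b F \<longleftrightarrow>
     set_borel_measurable lebesgue {a..b} F \<and>
     set_integrable lebesgue {a..b} (\<lambda>x. \<bar>F x\<bar> powr r)"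

text \<open>For \<open>a < x < b\<close> only values of \<open>F\<close> in \<open>[a,b]\<close> matter below, since \<open>h\<close> tends to \<open>0\<close>.
  Only at the two endpoints, a null set, does the notion depend on the values outside \<open>[a,b]\<close>.\<close>

definition has_Lr_derivative :: "real \<Rightarrow> (real \<Rightarrow> real) \<Rightarrow> real \<Rightarrow> real \<Rightarrow> bool" where
  "has_Lr_derivative r F \<alpha> x \<longleftrightarrow>
     (\<lambda>h. ((1 / h) * (LINT t:{-h..h}|lebesgue. \<bar>F (x + t) - F x - \<alpha> * t\<bar> powr r)) powr (1 / r))
       \<in> o[at_right 0](\<lambda>h. h)"

definition Lr_differentiable :: "real \<Rightarrow> (real \<Rightarrow> real) \<Rightarrow> real \<Rightarrow> bool" where
  "Lr_differentiable r F x \<longleftrightarrow> (\<exists>\<alpha>. has_Lr_derivative r F \<alpha> x)"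

text \<open>The library's partial tagged divisions consist of pairs (tag, interval) and admit one-point
  intervals, which are excluded here. The intervals need not cover \<open>[a,b]\<close>.\<close>

definition partition_in :: "real \<Rightarrow> real \<Rightarrow> (real \<times> real set) set \<Rightarrow> bool" where
  "partition_in a b P \<longleftrightarrow>
     P tagged_partial_division_of {a..b} \<and> (\<forall>(x, K) \<in> P. measure lebesgue K > 0)"

definition gauge_on :: "real set \<Rightarrow> (real \<Rightarrow> real) \<Rightarrow> bool" where
  "gauge_on E \<delta> \<longleftrightarrow> (\<forall>x\<in>E. \<delta> x > 0)"

text \<open>In \<open>real\<close>, \<open>ball x (\<delta> x)\<close> is the open interval \<open>(x - \<delta> x, x + \<delta> x)\<close>; for \<open>K = [c,d]\<close>,
  \<open>measure lebesgue K = d - c\<close>.\<close>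

definition AC_r :: "real \<Rightarrow> real \<Rightarrow> real \<Rightarrow> (real \<Rightarrow> real) \<Rightarrow> real set \<Rightarrow> bool" where
  "AC_r r a b F E \<longleftrightarrow>
     (\<forall>\<epsilon>>0. \<exists>\<eta>>0. \<exists>\<delta>. gauge_on E \<delta> \<and>
        (\<forall>P. partition_in a b P \<longrightarrow> fst ` P \<subseteq> E \<longrightarrow> (\<lambda>x. ball x (\<delta> x)) fine P \<longrightarrow>
             (\<Sum>(x, K)\<in>P. measure lebesgue K) < \<eta> \<longrightarrow>
             (\<Sum>(x, K)\<in>P. ((1 / measure lebesgue K) *
                (LINT y:K|lebesgue. \<bar>F y - F x\<bar> powr r)) powr (1 / r)) < \<epsilon>))"

definition ACG_r :: "real \<Rightarrow> real \<Rightarrow> real \<Rightarrow> (real \<Rightarrow> real) \<Rightarrow> bool" where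
  "ACG_r r a b F \<longleftrightarrow>
     (\<exists>E :: nat \<Rightarrow> real set. {a..b} = (\<Union>n. E n) \<and> (\<forall>n. AC_r r a b F (E n)))"

end

theory Submission imports Defs begin

text \<open>
  The proof is of Stepanov type: a bound on the difference quotients at every point of a set is improved to
  differentiability at almost every point of that set. Write \<open>I\<close> for an interval in \<open>[a, b]\<close> and consider the quotients
  \<open>((1 / |I|) * \<integral>\<^bsub>I\<^esub> |F - F x| powr r) powr (1 / r) / |I|\<close> over the intervals \<open>I\<close> that contain \<open>x\<close>.

  Their boundedness comes from a Vitali covering. If \<open>F\<close> is in \<open>AC_r\<close> of \<open>E\<close>, then at almost every point of \<open>E\<close>
  the quotients over short intervals are bounded (\<open>AC_r_difference_quotients_bounded\<close>): otherwise
  disjoint intervals of total length bounded below would have quotients above any \<open>M\<close>, which for large \<open>M\<close> contradicts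
  the bound on the sum over partitions. Hence almost all of \<open>[a, b]\<close> is the union of countably many sets on each of
  which the quotients have a uniform bound \<open>M\<close>.

  On such a set \<open>F\<close> is locally Lipschitz (\<open>lipschitz_of_Lr_difference_quotients\<close>). A small part \<open>S\<close> of it
  therefore carries a restriction of \<open>F\<close> that extends to a Lipschitz function \<open>G\<close> on the line, and
  \<open>G\<close> is differentiable almost everywhere (\<open>lipschitz_AE_differentiable\<close>).

  It remains to see that \<open>F - G\<close> is negligible in \<open>r\<close>-mean near almost every \<open>x\<close> in \<open>S\<close>. It vanishes on \<open>S\<close>,
  and on an interval that meets \<open>S\<close> its \<open>r\<close>-mean is at most a constant times the length. Almost every point of \<open>S\<close> is
  nonporous (\<open>negligible_porous_points\<close>): for each \<open>N\<close> and all small \<open>h\<close>, each of the \<open>N\<close> equal parts of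
  \<open>[x - h, x + h]\<close> meets \<open>S\<close>. Using the estimate on the parts improves the \<open>r\<close>-mean over the whole interval from
  a constant times \<open>h\<close> to a constant times \<open>h / N\<close> (\<open>Lr_approximation_at_nonporous_point\<close>), so
  \<open>F\<close> has the \<open>L\<^sup>r\<close>-derivative \<open>G' x\<close> at \<open>x\<close>.

  The sets \<open>E\<close> may fail to be measurable. This is why the argument rests on Vitali's theorem, the Lipschitz
  extension and nonporosity, which apply to arbitrary sets, rather than on Lebesgue density of \<open>S\<close>.
\<close>

section \<open>Differentiability of Lipschitz functions on the line\<close>

lemma lipschitz_continuous_on:
  fixes G :: "real \<Rightarrow> real"
  assumes "\<And>x y. \<bar>G x - G y\<bar> \<le> L * \<bar>x - y\<bar>"
  shows "continuous_on A G"
proof (rule lipschitz_on_continuous_on, rule lipschitz_onI)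
  show "dist (G x) (G y) \<le> \<bar>L\<bar> * dist x y" for x y
    using order_trans[OF assms mult_right_mono[of L "\<bar>L\<bar>" "\<bar>x - y\<bar>"]]
    by (simp add: dist_real_def)
qed auto

text \<open>The inverse \<open>q\<close> pushes Lebesgue measure forward to the measure \<open>A \<mapsto> |p ` A|\<close>, whose value on
  \<open>[x, y]\<close> is \<open>p y - p x\<close>. A Lipschitz map sends null sets to null sets, so this measure is absolutely
  continuous, and its Radon-Nikodym density is the required \<open>f\<close>. The lower bound on the slope of \<open>p\<close>
  is what makes the inverse exist on the whole line.\<close>

lemma lipschitz_increasing_has_density:
  fixes p :: "real \<Rightarrow> real" and L :: real
  assumes lip: "\<And>x y. \<bar>p x - p y\<bar> \<le> L * \<bar>x - y\<bar>"
    and expand: "\<And>x y. x \<le> y \<Longrightarrow> y - x \<le> p y - p x"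
  obtains f :: "real \<Rightarrow> real" where "\<And>x y. x \<le> y \<Longrightarrow> (f has_integral (p y - p x)) {x..y}"
proof -
  have inc: "x < y \<Longrightarrow> p x < p y" for x y
    using expand[of x y] by linarith
  have inj: "p x = p y \<longleftrightarrow> x = y" for x y
    using inc by (metis linorder_less_linear order_less_irrefl)
  have le_iff: "p x \<le> p y \<longleftrightarrow> x \<le> y" for x y
    using inc by (metis linorder_not_le order_le_less)
  have "continuous_on UNIV p"
    using lip by (rule lipschitz_continuous_on)
  have surj: "\<exists>x. p x = z" for z
  proof -
    define m where "m = \<bar>z - p 0\<bar>"
    have "p (-m) \<le> z" "z \<le> p m"
      using expand[of "-m" 0] expand[of 0 m] unfolding m_def by auto
    moreover have "continuous_on {-m..m} p"
      using \<open>continuous_on UNIV p\<close> continuous_on_subset by blast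
    ultimately show ?thesis
      using IVT'[of p "-m" z m] by (auto simp: m_def)
  qed
  define q where "q = inv p"
  have pq: "p (q z) = z" for z
    unfolding q_def using surj by (metis f_inv_into_f rangeI)
  have qp: "q (p x) = x" for x
    using inj pq by blast
  have "mono q"
    by (rule monoI) (metis le_iff pq)
  then have q[measurable]: "q \<in> borel_measurable borel"
    by (rule borel_measurable_mono)
  define \<mu> where "\<mu> = distr lborel borel q"
  have preimage: "q -` A = p ` A" for A
    using pq qp by (auto simp: image_iff) metis
  have ac: "absolutely_continuous lborel \<mu>"
    unfolding absolutely_continuous_def
  proof
    fix N :: "real set" assume N: "N \<in> null_sets lborel"
    then have "negligible N"
      using null_sets_completionI negligible_iff_null_sets by blast
    then have "negligible (p ` N)"
      by (rule negligible_locally_Lipschitz_image[rotated]) (use lip in \<open>auto intro!: exI[of _ UNIV] exI[of _ L]\<close>)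
    moreover have NB: "N \<in> sets borel"
      using N by auto
    then have "q -` N \<in> sets borel"
      using measurable_sets[OF q, of N] by simp
    ultimately have "emeasure lborel (q -` N) = 0"
      by (simp add: preimage negligible_iff_emeasure0 )
    then show "N \<in> null_sets \<mu>"
      using NB by (simp add: \<mu>_def null_sets_def emeasure_distr)
  qed
  obtain f where f[measurable]: "f \<in> borel_measurable lborel" and dens: "density lborel f = \<mu>"
    using sigma_finite_measure.Radon_Nikodym[OF sigma_finite_lborel ac] by (auto simp: \<mu>_def)
  have nn: "(\<integral>\<^sup>+t. f t * indicator {x..y} t \<partial>lborel) = ennreal (p y - p x)" if "x \<le> y" for x y
  proof -
    have "(\<integral>\<^sup>+t. f t * indicator {x..y} t \<partial>lborel) = emeasure (density lborel f) {x..y}"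
      by (subst emeasure_density) auto
    also have "\<dots> = emeasure lborel (q -` {x..y})"
      unfolding dens \<mu>_def by (subst emeasure_distr) auto
    also have "q -` {x..y} = {p x..p y}"
      using le_iff[of x "q _"] le_iff[of "q _" y] by (auto simp: pq)
    finally show ?thesis
      using le_iff that by simp
  qed
  have hi: "((\<lambda>t. enn2real (f t)) has_integral (p y - p x)) {x..y}" if "x \<le> y" for x y
  proof -
    \<comment> \<open>The density takes extended values, but on \<open>[x, y]\<close> its integral is finite, so it is
      infinite only on a null set and may be replaced by its real part.\<close>
    have "AE t in lborel. f t * indicator {x..y} t \<noteq> \<infinity>"
      by (rule nn_integral_PInf_AE) (auto simp: nn[OF that])
    then have "AE t in lborel. f t * indicator {x..y} t = ennreal (indicator {x..y} t * enn2real (f t))"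
      by eventually_elim (auto simp: indicator_def less_top)
    then have "(\<integral>\<^sup>+t. ennreal (indicator {x..y} t * enn2real (f t)) \<partial>lborel) = ennreal (p y - p x)"
      using nn[OF that] by (subst nn_integral_cong_AE[symmetric]) auto
    then have "((\<lambda>t. indicator {x..y} t * enn2real (f t)) has_integral (p y - p x)) UNIV"
      by (intro nn_integral_has_integral) (use le_iff that in auto)
    then show ?thesis
      by (rule has_integral_restrict_UNIV[THEN iffD1, OF has_integral_eq[rotated]])
         (auto simp: indicator_def)
  qed
  then show ?thesis by (rule that)
qed

text \<open>Rademacher's theorem on the line. Adding a linear function of large slope makes \<open>g\<close> increasing
  with slope at least \<open>1\<close>, hence an indefinite integral, and an indefinite integral has the
  integrand as its derivative at almost every point. The differentiation theorem gives the right derivative;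
  applying it to the reflected integrand gives the left derivative, with the same value
  because both are values of one and the same density.\<close>

lemma lipschitz_AE_differentiable:
  fixes g :: "real \<Rightarrow> real" and L :: real
  assumes lip: "\<And>x y. \<bar>g x - g y\<bar> \<le> L * \<bar>x - y\<bar>"
  shows "negligible {x. \<nexists>D. (g has_real_derivative D) (at x)}"
proof -
  define p where "p x = g x + (L + 1) * x" for x
  have "\<bar>p x - p y\<bar> \<le> (2 * L + 1) * \<bar>x - y\<bar>" for x y
  proof -
    have "L * \<bar>x - y\<bar> \<ge> 0" using lip[of x y] by linarith
    then have "L \<ge> 0 \<or> x = y" by (auto simp: zero_le_mult_iff)
    then have "\<bar>(L + 1) * (x - y)\<bar> = (L + 1) * \<bar>x - y\<bar>" by (auto simp: abs_mult)
    moreover have "p x - p y = (g x - g y) + (L + 1) * (x - y)" by (simp add: p_def algebra_simps)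
    ultimately show ?thesis using lip[of x y] by (simp add: algebra_simps)
  qed
  moreover have "y - x \<le> p y - p x" if "x \<le> y" for x y
    using lip[of y x] that by (simp add: p_def algebra_simps)
  ultimately obtain f where f: "\<And>x y. x \<le> y \<Longrightarrow> (f has_integral (p y - p x)) {x..y}"
    using lipschitz_increasing_has_density by blast
  have rf: "((\<lambda>t. f (- t)) has_integral (p (- x) - p (- y))) {x..y}" if "x \<le> y" for x y
    using f[of "-y" "-x"] that 
    by (simp flip: has_integral_reflect_real[of f _ "-x" "-y"])
  have "f integrable_on cbox x y" for x y
    by (cases "x \<le> y") (use f in \<open>auto simp: integrable_on_def\<close>)
  then obtain N1 where N1: "negligible N1"
      "\<And>x e. \<lbrakk>x \<notin> N1; 0 < e\<rbrakk> \<Longrightarrow> \<exists>d>0. \<forall>h. 0 < h \<and> h < d \<longrightarrow>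
         norm (integral (cbox x (x + h *\<^sub>R One)) f /\<^sub>R h ^ DIM(real) - f x) < e"
    using integrable_ccontinuous_explicit[of f] by blast
  have "(\<lambda>t. f (-t)) integrable_on cbox x y" for x y
    by (cases "x \<le> y") (use rf in \<open>auto simp: integrable_on_def\<close>)
  then obtain N2 where N2: "negligible N2"
      "\<And>x e. \<lbrakk>x \<notin> N2; 0 < e\<rbrakk> \<Longrightarrow> \<exists>d>0. \<forall>h. 0 < h \<and> h < d \<longrightarrow>
         norm (integral (cbox x (x + h *\<^sub>R One)) (\<lambda>t. f (-t)) /\<^sub>R h ^ DIM(real) - f (-x)) < e"
    using integrable_ccontinuous_explicit[of "\<lambda>t. f (-t)"] by blast
  have deriv: "(g has_real_derivative (f x - (L + 1))) (at x)" if x: "x \<notin> N1" "- x \<notin> N2" for x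
  proof -
    have "(\<lambda>h. (p (x + h) - p x) / h) \<midarrow>0\<rightarrow> f x"
    proof (rule LIM_I)
      fix e :: real assume "e > 0"
      obtain d1 where d1: "d1 > 0" "\<And>h. 0 < h \<Longrightarrow> h < d1 \<Longrightarrow> \<bar>(p (x + h) - p x) / h - f x\<bar> < e"
      proof -
        obtain d where "d > 0" and d: "\<And>h. 0 < h \<and> h < d \<Longrightarrow>
          norm (integral (cbox x (x + h *\<^sub>R One)) f /\<^sub>R h ^ DIM(real) - f x) < e"
          using N1(2)[OF x(1) \<open>e > 0\<close>] by blast
        have "\<bar>(p (x + h) - p x) / h - f x\<bar> < e" if "0 < h" "h < d" for h
          using d[of h] integral_unique[OF f[of x "x + h"]] that
          by (simp add: divide_inverse mult.commute)
        then show thesis using \<open>d > 0\<close> that by blast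
      qed
      obtain d2 where d2: "d2 > 0"
          "\<And>h. 0 < h \<Longrightarrow> h < d2 \<Longrightarrow> \<bar>(p x - p (x - h)) / h - f x\<bar> < e"
      proof -
        obtain d where "d > 0" and d: "\<And>h. 0 < h \<and> h < d \<Longrightarrow> 
          norm (integral (cbox (-x) (-x + h *\<^sub>R One)) (\<lambda>t. f (-t)) /\<^sub>R h ^ DIM(real) - f (- (- x))) < e"
          using N2(2)[OF x(2) \<open>e > 0\<close>] by blast
        have "\<bar>(p x - p (x - h)) / h - f x\<bar> < e" if "0 < h" "h < d" for h
          using d[of h] integral_unique[OF rf[of "-x" "-x + h"]] that
          by (simp add: divide_inverse mult.commute)
        then show thesis using \<open>d > 0\<close> that by blast
      qed
      have "\<bar>(p (x + h) - p x) / h - f x\<bar> < e" if "h \<noteq> 0" "\<bar>h\<bar> < min d1 d2" for h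
      proof (cases "h > 0")
        case False
        then have "(p (x + h) - p x) / h = (p x - p (x - (- h))) / (- h)"
          using that by (simp add: field_simps)
        then show ?thesis using d2(2)[of "-h"] that False by simp
      qed (use d1 that in auto)
      then show "\<exists>s>0. \<forall>h. h \<noteq> 0 \<and> norm (h - 0) < s \<longrightarrow> norm ((p (x + h) - p x) / h - f x) < e"
        using d1 d2 by (intro exI[of _ "min d1 d2"]) auto
    qed
    then have "(p has_real_derivative f x) (at x)"
      by (simp add: DERIV_def)
    then have "((\<lambda>x. p x - (L + 1) * x) has_real_derivative (f x - (L + 1))) (at x)"
      by (auto intro!: derivative_eq_intros)
    then show ?thesis by (simp add: p_def)
  qed
  have "negligible (uminus ` N2)"
    using N2(1) by (rule negligible_locally_Lipschitz_image[rotated])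
      (auto intro!: exI[of _ "UNIV :: real set"] exI[of _ "1 :: real"])
  then have "negligible (N1 \<union> uminus ` N2)"
    using N1(1) by simp
  then show ?thesis
    by (rule negligible_subset) (use deriv in force)
qed

section \<open>Lipschitz extension\<close>

text \<open>McShane's construction: the largest \<open>L\<close>-Lipschitz function below all the cones
  \<open>x \<mapsto> F s + L * |x - s|\<close>. The Lipschitz condition on \<open>S\<close> says that no cone passes below a point of the
  graph of \<open>F\<close> over \<open>S\<close>, so at such a point the infimum is the value of \<open>F\<close>.\<close>

lemma lipschitz_extension:
  fixes F :: "real \<Rightarrow> real"
  assumes lip: "\<And>x y. x \<in> S \<Longrightarrow> y \<in> S \<Longrightarrow> \<bar>F x - F y\<bar> \<le> L * \<bar>x - y\<bar>" and "L \<ge> 0" and "S \<noteq> {}"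
  obtains G :: "real \<Rightarrow> real"
  where "\<And>x y. \<bar>G x - G y\<bar> \<le> L * \<bar>x - y\<bar>" and "\<And>x. x \<in> S \<Longrightarrow> G x = F x"
proof -
  define G where "G x = (INF s\<in>S. F s + L * \<bar>x - s\<bar>)" for x
  obtain s0 where "s0 \<in> S" using \<open>S \<noteq> {}\<close> by blast
  have tri: "L * \<bar>x - z\<bar> \<le> L * \<bar>x - y\<bar> + L * \<bar>y - z\<bar>" for x y z
    using mult_left_mono[OF _ \<open>L \<ge> 0\<close>, of "\<bar>x - z\<bar>" "\<bar>x - y\<bar> + \<bar>y - z\<bar>"]
    by (simp add: distrib_left)
  have bdd: "bdd_below ((\<lambda>s. F s + L * \<bar>x - s\<bar>) ` S)" for x
  proof (rule bdd_belowI2)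
    show "F s0 - L * \<bar>s0 - x\<bar> \<le> F s + L * \<bar>x - s\<bar>" if "s \<in> S" for s
      using lip[OF \<open>s0 \<in> S\<close> that] tri[of s0 s x] by linarith
  qed
  have le: "G x \<le> G y + L * \<bar>x - y\<bar>" for x y
  proof -
    have "G x - L * \<bar>x - y\<bar> \<le> G y"
      unfolding G_def[of y]
    proof (rule cINF_greatest)
      show "G x - L * \<bar>x - y\<bar> \<le> F s + L * \<bar>y - s\<bar>" if "s \<in> S" for s
        using cINF_lower[OF bdd[of x] that] tri[of x s y] by (simp add: G_def)
    qed (use \<open>S \<noteq> {}\<close> in auto)
    then show ?thesis by simp
  qed
  show thesis
  proof (rule that)
    show "\<bar>G x - G y\<bar> \<le> L * \<bar>x - y\<bar>" for x y
      using le[of x y] le[of y x] by (simp add: abs_le_iff abs_minus_commute)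
    show "G x = F x" if "x \<in> S" for x
    proof (rule antisym)
      show "G x \<le> F x"
        using cINF_lower[OF bdd[of x] that] by (simp add: G_def)
      show "F x \<le> G x"
        unfolding G_def
      proof (rule cINF_greatest)
        show "F x \<le> F s + L * \<bar>x - s\<bar>" if "s \<in> S" for s
          using lip[OF \<open>x \<in> S\<close> that] by linarith
      qed (use \<open>S \<noteq> {}\<close> in auto)
    qed
  qed
qed

section \<open>Porosity\<close>

text \<open>The gaps of \<open>S\<close> near \<open>x\<close> are of smaller order than their distance from \<open>x\<close>. It
  takes the place of Lebesgue density and is meaningful for nonmeasurable \<open>S\<close>.\<close>

definition nonporous_at :: "real set \<Rightarrow> real \<Rightarrow> bool" where
  "nonporous_at S x \<longleftrightarrow>
     (\<forall>e>0. \<exists>d>0. \<forall>y. \<bar>y - x\<bar> < d \<longrightarrow> (\<exists>s\<in>S. \<bar>y - s\<bar> \<le> e * \<bar>y - x\<bar>))"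

text \<open>The distance to \<open>S\<close> is \<open>1\<close>-Lipschitz, hence differentiable almost everywhere. At a point of \<open>S\<close>
  it attains its minimum \<open>0\<close>, so wherever its derivative exists there, the derivative is \<open>0\<close>; and this is
  nonporosity.\<close>

lemma negligible_porous_points:
  "negligible {x \<in> S. \<not> nonporous_at S x}"
proof (cases "S = {}")
  case False
  let ?g = "\<lambda>x. infdist x S"
  have lip: "\<bar>?g x - ?g y\<bar> \<le> 1 * \<bar>x - y\<bar>" for x y
    using infdist_triangle_abs[of x S y] by (simp add: dist_real_def)
  have "nonporous_at S x" if "x \<in> S" and D: "(?g has_real_derivative D) (at x)" for x D
    unfolding nonporous_at_def
  proof (intro allI impI)
    fix e :: real assume "e > 0"
    have g0: "?g x = 0" using that by simp
    have "D = 0"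
      by (rule DERIV_local_min[OF D, of 1]) (auto simp: g0 infdist_nonneg)
    then have "(\<lambda>h. (?g (x + h) - ?g x) / h) \<midarrow>0\<rightarrow> 0"
      using D by (simp add: DERIV_def)
    then obtain d where "d > 0" and d: "\<And>h. h \<noteq> 0 \<Longrightarrow> \<bar>h\<bar> < d \<Longrightarrow> \<bar>?g (x + h) / h\<bar> < e"
      using LIM_D[of _ 0 0 e] \<open>e > 0\<close> by (force simp: g0)
    have "\<exists>s\<in>S. \<bar>y - s\<bar> \<le> e * \<bar>y - x\<bar>" if "\<bar>y - x\<bar> < d" for y
    proof (cases "y = x")
      case True
      then show ?thesis using \<open>x \<in> S\<close> by auto
    next
      case False
      then have "?g y < e * \<bar>y - x\<bar>"
        using d[of "y - x"] that by (simp add: abs_divide infdist_nonneg pos_divide_less_eq)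
      then have "(INF s\<in>S. dist y s) < e * \<bar>y - x\<bar>"
        using \<open>S \<noteq> {}\<close> by (simp add: infdist_notempty)
      moreover have "bdd_below (dist y ` S)"
        by (rule bdd_belowI2[of _ 0]) simp
      ultimately obtain s where "s \<in> S" "dist y s < e * \<bar>y - x\<bar>"
        using cINF_less_iff[of S "dist y"] \<open>S \<noteq> {}\<close> by blast
      then show ?thesis
        by (intro bexI[of _ s]) (simp_all add: dist_real_def)
    qed
    then show "\<exists>d>0. \<forall>y. \<bar>y - x\<bar> < d \<longrightarrow> (\<exists>s\<in>S. \<bar>y - s\<bar> \<le> e * \<bar>y - x\<bar>)"
      using \<open>d > 0\<close> by blast
  qed
  then show ?thesis
    by (intro negligible_subset[OF lipschitz_AE_differentiable[OF lip]]) blast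
qed simp

section \<open>Integrals of powers of differences\<close>

text \<open>A cheap substitute for Minkowski's inequality: the constant \<open>2 powr r\<close> does no harm anywhere below.\<close>

lemma abs_add_powr_le:
  fixes u v r :: real
  assumes "r \<ge> 0"
  shows "\<bar>u + v\<bar> powr r \<le> 2 powr r * (\<bar>u\<bar> powr r + \<bar>v\<bar> powr r)"
proof -
  have "\<bar>u + v\<bar> powr r \<le> (2 * max \<bar>u\<bar> \<bar>v\<bar>) powr r"
    using assms by (intro powr_mono2) auto
  also have "\<dots> = 2 powr r * max \<bar>u\<bar> \<bar>v\<bar> powr r"
    by (simp add: powr_mult)
  also have "max \<bar>u\<bar> \<bar>v\<bar> powr r \<le> \<bar>u\<bar> powr r + \<bar>v\<bar> powr r"
    by (simp add: max_def)
  finally show ?thesis by simp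
qed

lemma in_Lr_integrable_diff_continuous:
  assumes "1 \<le> r" and F: "in_Lr r a b F" and g: "continuous_on {a..b} g"
  shows "(\<lambda>y. \<bar>F y - g y\<bar> powr r) integrable_on {a..b}"
proof -
  have "set_integrable lebesgue {a..b} (\<lambda>y. \<bar>F y - g y\<bar> powr r)"
  proof (rule set_integrable_bound)
    have "(\<lambda>y. \<bar>g y\<bar> powr r) absolutely_integrable_on {a..b}"
      using \<open>1 \<le> r\<close> by (intro absolutely_integrable_continuous_real continuous_on_powr' continuous_intros g) auto
    then show "set_integrable lebesgue {a..b} (\<lambda>y. 2 powr r * (\<bar>F y\<bar> powr r + \<bar>g y\<bar> powr r))"
      using F by (intro set_integrable_mult_right set_integral_add) (auto simp: in_Lr_def)
    have "(\<lambda>y. indicator {a..b} y *\<^sub>R g y) \<in> borel_measurable borel"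
      by (rule borel_measurable_continuous_on_indicator) (use g in auto)
    then have "(\<lambda>y. indicator {a..b} y *\<^sub>R g y) \<in> borel_measurable lebesgue"
      by (simp add: measurable_completion)
    moreover have "(\<lambda>y. indicator {a..b} y *\<^sub>R F y) \<in> borel_measurable lebesgue"
      using F by (simp add: in_Lr_def set_borel_measurable_def)
    ultimately have "(\<lambda>y. \<bar>indicator {a..b} y *\<^sub>R F y - indicator {a..b} y *\<^sub>R g y\<bar> powr r)
        \<in> borel_measurable lebesgue"
      by (intro powr_real_measurable borel_measurable_abs borel_measurable_diff) auto
    also have "(\<lambda>y. \<bar>indicator {a..b} y *\<^sub>R F y - indicator {a..b} y *\<^sub>R g y\<bar> powr r)
        = (\<lambda>y. indicator {a..b} y *\<^sub>R (\<bar>F y - g y\<bar> powr r))"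
      by (auto simp: indicator_def)
    finally show "set_borel_measurable lebesgue {a..b} (\<lambda>y. \<bar>F y - g y\<bar> powr r)"
      by (simp add: set_borel_measurable_def)
    show "AE y in lebesgue. y \<in> {a..b} \<longrightarrow>
        norm (\<bar>F y - g y\<bar> powr r) \<le> norm (2 powr r * (\<bar>F y\<bar> powr r + \<bar>g y\<bar> powr r))"
      using abs_add_powr_le[of r "F _" "- g _"] \<open>1 \<le> r\<close> by simp
  qed
  then show ?thesis
    by (rule set_lebesgue_integral_eq_integral(1))
qed

lemma set_lebesgue_integral_nonneg_eq_integral:
  fixes f :: "real \<Rightarrow> real"
  assumes "f integrable_on S" "\<And>x. x \<in> S \<Longrightarrow> 0 \<le> f x"
  shows "(LINT x:S|lebesgue. f x) = integral S f"
  by (rule set_lebesgue_integral_eq_integral(2), rule nonnegative_absolutely_integrable_1)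
     (use assms in auto)

lemma integral_abs_add_powr_le:
  fixes f u v :: "real \<Rightarrow> real"
  assumes "r \<ge> 0" "(\<lambda>y. \<bar>u y + v y\<bar> powr r) integrable_on S"
    "(\<lambda>y. \<bar>u y\<bar> powr r) integrable_on S" "(\<lambda>y. \<bar>v y\<bar> powr r) integrable_on S"
  shows "integral S (\<lambda>y. \<bar>u y + v y\<bar> powr r)
    \<le> 2 powr r * (integral S (\<lambda>y. \<bar>u y\<bar> powr r) + integral S (\<lambda>y. \<bar>v y\<bar> powr r))"
proof -
  have "integral S (\<lambda>y. \<bar>u y + v y\<bar> powr r)
      \<le> integral S (\<lambda>y. 2 powr r * (\<bar>u y\<bar> powr r + \<bar>v y\<bar> powr r))"
    using assms by (intro integral_le abs_add_powr_le integrable_on_mult_right integrable_add) auto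
  also have "\<dots> = 2 powr r * (integral S (\<lambda>y. \<bar>u y\<bar> powr r) + integral S (\<lambda>y. \<bar>v y\<bar> powr r))"
    using assms by (simp add: integral_add)
  finally show ?thesis .
qed

lemma integral_powr_le_of_bound:
  fixes u :: "real \<Rightarrow> real"
  assumes "r \<ge> 0" "c \<le> d" "(\<lambda>y. \<bar>u y\<bar> powr r) integrable_on {c..d}"
    and "\<And>y. y \<in> {c..d} \<Longrightarrow> \<bar>u y\<bar> \<le> B"
  shows "integral {c..d} (\<lambda>y. \<bar>u y\<bar> powr r) \<le> B powr r * (d - c)"
proof -
  have "integral {c..d} (\<lambda>y. \<bar>u y\<bar> powr r) \<le> integral {c..d} (\<lambda>y. B powr r)"
    using assms by (intro integral_le powr_mono2) auto
  then show ?thesis using \<open>c \<le> d\<close> by (simp add: mult.commute)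
qed

lemma integral_le_equal_pieces:
  fixes f :: "real \<Rightarrow> real"
  assumes "l \<ge> 0" "f integrable_on {u..u + real N * l}"
    and "\<And>i. i < N \<Longrightarrow> integral {u + real i * l..u + real i * l + l} f \<le> B"
  shows "integral {u..u + real N * l} f \<le> real N * B"
  using assms(2,3)
proof (induction N)
  case (Suc N)
  let ?m = "u + real N * l"
  have eq: "u + real (Suc N) * l = ?m + l"
    by (simp add: algebra_simps)
  have "integral {u..?m + l} f = integral {u..?m} f + integral {?m..?m + l} f"
    using Suc.prems(1) \<open>l \<ge> 0\<close> unfolding eq by (intro Henstock_Kurzweil_Integration.integral_combine[symmetric]) auto
  moreover have "integral {u..?m} f \<le> real N * B"
    using Suc.prems \<open>l \<ge> 0\<close> unfolding eq 
    by (intro Suc.IH) (auto intro: integrable_subinterval_real)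
  moreover have "integral {?m..?m + l} f \<le> B"
    using Suc.prems(2)[of N] by simp
  ultimately show ?case
    unfolding eq by (simp add: algebra_simps)
qed simp

section \<open>Derivatives in the mean at nonporous points\<close>

text \<open>On an interval that meets the set where \<open>F\<close> and \<open>G\<close> agree, both functions stay within the length of
  the interval, up to a constant, of their common value there: \<open>F\<close> in \<open>r\<close>-mean, \<open>G\<close> pointwise.\<close>

lemma Lr_deviation_from_lipschitz:
  assumes "1 \<le> r" and F: "in_Lr r a b F" and G: "\<And>x y. \<bar>G x - G y\<bar> \<le> L * \<bar>x - y\<bar>"
    and "a \<le> c" "c \<le> s" "s \<le> d" "d \<le> b" "M \<ge> 0" "L \<ge> 0" "F s = G s"
    and M: "integral {c..d} (\<lambda>y. \<bar>F y - F s\<bar> powr r) \<le> (M * (d - c)) powr r * (d - c)"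
  shows "integral {c..d} (\<lambda>y. \<bar>F y - G y\<bar> powr r)
    \<le> 2 powr r * (M powr r + L powr r) * (d - c) powr r * (d - c)"
proof -
  have sub: "{c..d} \<subseteq> {a..b}" using assms by auto
  have cont: "continuous_on A G" for A
    using G by (rule lipschitz_continuous_on)
  have int: "(\<lambda>y. \<bar>F y - g y\<bar> powr r) integrable_on {c..d}" if "continuous_on {a..b} g" for g
    using in_Lr_integrable_diff_continuous[OF \<open>1 \<le> r\<close> F that] sub
    by (rule integrable_on_subinterval)
  have intG: "(\<lambda>y. \<bar>F s - G y\<bar> powr r) integrable_on {c..d}"
    using \<open>1 \<le> r\<close> by (intro integrable_continuous_real continuous_on_powr' continuous_intros cont) auto
  have "integral {c..d} (\<lambda>y. \<bar>F s - G y\<bar> powr r) \<le> (L * (d - c)) powr r * (d - c)"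
  proof (rule integral_powr_le_of_bound)
    show "\<bar>F s - G y\<bar> \<le> L * (d - c)" if "y \<in> {c..d}" for y
    proof -
      have "L * \<bar>s - y\<bar> \<le> L * (d - c)"
        using that assms by (intro mult_left_mono) auto
      then show ?thesis using G[of s y] \<open>F s = G s\<close> by simp
    qed
  qed (use intG assms in auto)
  moreover have "integral {c..d} (\<lambda>y. \<bar>F y - G y\<bar> powr r)
     \<le> 2 powr r * (integral {c..d} (\<lambda>y. \<bar>F y - F s\<bar> powr r) + integral {c..d} (\<lambda>y. \<bar>F s - G y\<bar> powr r))"
    using integral_abs_add_powr_le[of r "\<lambda>y. F y - F s" "\<lambda>y. F s - G y" "{c..d}"] \<open>1 \<le> r\<close>
      int[OF cont] int[of "\<lambda>_. F s"] intG by auto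
  ultimately have "integral {c..d} (\<lambda>y. \<bar>F y - G y\<bar> powr r)
     \<le> 2 powr r * ((M * (d - c)) powr r * (d - c) + (L * (d - c)) powr r * (d - c))"
    using M by (smt (verit, best) mult_left_mono powr_ge_zero)
  moreover have "(M * (d - c)) powr r = M powr r * (d - c) powr r"
    and "(L * (d - c)) powr r = L powr r * (d - c) powr r"
    using assms by (simp_all add: powr_mult)
  ultimately show ?thesis
    by (simp only: distrib_left distrib_right mult.assoc)
qed

text \<open>Nonporosity turns a bound of order \<open>O(h)\<close> into one of order \<open>o(h)\<close>. Cut \<open>[x - h, x + h]\<close> into
  \<open>N\<close> equal intervals. For small \<open>h\<close> each of them contains a point of \<open>S\<close>, so the preceding lemma bounds
  the \<open>r\<close>-th power integral of \<open>F - G\<close> over each piece by a constant times \<open>(h / N) powr r * (h / N)\<close>.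
  The sum over the \<open>N\<close> pieces is then a constant times \<open>(h / N) powr r * h\<close>, where \<open>N\<close> is as large as
  desired. The error of the linear approximation of \<open>G\<close> is at most \<open>h / N\<close> for small \<open>h\<close> and contributes a
  term of the same form.\<close>

lemma Lr_approximation_at_nonporous_point:
  fixes N :: nat
  assumes "1 \<le> r" and F: "in_Lr r a b F" and G: "\<And>x y. \<bar>G x - G y\<bar> \<le> L * \<bar>x - y\<bar>"
    and FG: "\<And>s. s \<in> S \<Longrightarrow> F s = G s" and "M \<ge> 0" "L \<ge> 0" "\<rho> > 0"
    and M: "\<And>s c d. \<lbrakk>s \<in> S; a \<le> c; c \<le> s; s \<le> d; d \<le> b; c < d; d - c < \<rho>\<rbrakk> \<Longrightarrow>
      integral {c..d} (\<lambda>y. \<bar>F y - F s\<bar> powr r) \<le> (M * (d - c)) powr r * (d - c)"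
    and "a < x" "x < b" "x \<in> S" and por: "nonporous_at S x"
    and deriv: "(G has_real_derivative \<alpha>) (at x)" and "N > 0"
  defines "K \<equiv> 2 powr r * (4 powr r * (M powr r + L powr r) * 2 + 2)"
  shows "\<exists>\<delta>>0. \<forall>h. 0 < h \<and> h < \<delta> \<longrightarrow> {x - h..x + h} \<subseteq> {a..b} \<and>
    integral {x - h..x + h} (\<lambda>y. \<bar>F y - F x - \<alpha> * (y - x)\<bar> powr r) \<le> K * (h / N) powr r * h"
proof -
  have "1 / real N > 0" using \<open>N > 0\<close> by simp
  then obtain d1 where "d1 > 0" and
    d1: "\<And>y. \<bar>y - x\<bar> < d1 \<Longrightarrow> \<exists>s\<in>S. \<bar>y - s\<bar> \<le> 1 / real N * \<bar>y - x\<bar>"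
    using por unfolding nonporous_at_def by blast
  have "(\<lambda>h. (G (x + h) - G x) / h) \<midarrow>0\<rightarrow> \<alpha>"
    using deriv by (simp add: DERIV_def)
  from LIM_D[OF this \<open>1 / real N > 0\<close>] obtain d2 where "d2 > 0" and
    d2: "\<And>h. h \<noteq> 0 \<Longrightarrow> \<bar>h\<bar> < d2 \<Longrightarrow> \<bar>(G (x + h) - G x) / h - \<alpha>\<bar> < 1 / real N"
    unfolding real_norm_def diff_zero by blast
  have d2': "\<bar>G y - G x - \<alpha> * (y - x)\<bar> \<le> 1 / real N * \<bar>y - x\<bar>" if "\<bar>y - x\<bar> < d2" for y
  proof (cases "y = x")
    case False
    then have "G y - G x - \<alpha> * (y - x) = ((G (x + (y - x)) - G x) / (y - x) - \<alpha>) * (y - x)"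
      by (simp add: field_simps)
    then show ?thesis
      using d2[of "y - x"] False that by (simp only: abs_mult) (intro mult_right_mono, auto)
  qed simp
  define \<delta> where "\<delta> = Min {d1, d2, \<rho> / 2, x - a, b - x}"
  have "\<delta> > 0" using \<open>d1 > 0\<close> \<open>d2 > 0\<close> \<open>\<rho> > 0\<close> \<open>a < x\<close> \<open>x < b\<close> by (simp add: \<delta>_def)
  moreover have "integral {x - h..x + h} (\<lambda>y. \<bar>F y - F x - \<alpha> * (y - x)\<bar> powr r) \<le> K * (h / N) powr r * h"
    and "{x - h..x + h} \<subseteq> {a..b}" if "0 < h" "h < \<delta>" for h
  proof -
    have h: "h < d1" "h < d2" "2 * h < \<rho>" "a < x - h" "x + h < b"
      using \<open>h < \<delta>\<close> by (auto simp: \<delta>_def)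
    then show sub: "{x - h..x + h} \<subseteq> {a..b}" by auto
    have cont: "continuous_on A G" for A
      using G by (rule lipschitz_continuous_on)
    have int: "(\<lambda>y. \<bar>F y - g y\<bar> powr r) integrable_on {x - h..x + h}" if "continuous_on {a..b} g" for g
      using in_Lr_integrable_diff_continuous[OF \<open>1 \<le> r\<close> F that] sub
      by (rule integrable_on_subinterval)
    define l where "l = 2 * h / N"
    have "l > 0" using \<open>0 < h\<close> \<open>N > 0\<close> by (simp add: l_def)
    have Nl: "x - h + real N * l = x + h" using \<open>N > 0\<close> by (simp add: l_def)
    have pieces: "integral {x - h..x - h + real N * l} (\<lambda>y. \<bar>F y - G y\<bar> powr r)
        \<le> real N * (2 powr r * (M powr r + L powr r) * l powr r * l)"
    proof (rule integral_le_equal_pieces)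
      fix i assume "i < N"
      define c where "c = x - h + real i * l"
      have "real (Suc i) * l \<le> real N * l"
        using \<open>i < N\<close> \<open>l > 0\<close> by (intro mult_right_mono) auto
      then have c: "x - h \<le> c" "c + l \<le> x + h"
        using Nl \<open>l > 0\<close> by (auto simp: c_def algebra_simps)
      have "l \<le> 2 * h" using \<open>0 < h\<close> \<open>N > 0\<close> by (simp add: l_def field_simps)
      \<comment> \<open>The midpoint of the piece lies within \<open>h / N\<close>, half the length of the piece, of a
        point of \<open>S\<close>, so that point lies in the piece.\<close>
      let ?y = "c + l / 2"
      have "\<bar>?y - x\<bar> \<le> h" using c \<open>l > 0\<close> by (simp add: abs_le_iff)
      then obtain s where "s \<in> S" and s: "\<bar>?y - s\<bar> \<le> 1 / real N * \<bar>?y - x\<bar>"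
        using d1[of ?y] h by auto
      have "\<bar>?y - s\<bar> \<le> 1 / real N * h"
        using s \<open>\<bar>?y - x\<bar> \<le> h\<close> \<open>N > 0\<close> by (meson mult_left_mono order_trans divide_nonneg_nonneg zero_le_one of_nat_0_le_iff)
      then have "\<bar>?y - s\<bar> \<le> l / 2" by (simp add: l_def)
      then have cs: "c \<le> s" "s \<le> c + l" by linarith+
      have "integral {c..c + l} (\<lambda>y. \<bar>F y - F s\<bar> powr r) \<le> (M * (c + l - c)) powr r * (c + l - c)"
        using M[OF \<open>s \<in> S\<close> _ cs] c h \<open>l > 0\<close> \<open>l \<le> 2 * h\<close> by simp
      then have "integral {c..c + l} (\<lambda>y. \<bar>F y - G y\<bar> powr r)
          \<le> 2 powr r * (M powr r + L powr r) * (c + l - c) powr r * (c + l - c)"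
        using c h cs by (intro Lr_deviation_from_lipschitz[OF \<open>1 \<le> r\<close> F G _ _ _ _ \<open>M \<ge> 0\<close> \<open>L \<ge> 0\<close> FG[OF \<open>s \<in> S\<close>]]) auto
      then show "integral {x - h + real i * l..x - h + real i * l + l} (\<lambda>y. \<bar>F y - G y\<bar> powr r)
          \<le> 2 powr r * (M powr r + L powr r) * l powr r * l"
        by (simp add: c_def)
    qed (use \<open>l > 0\<close> int[OF cont] in \<open>auto simp only: Nl less_imp_le\<close>)
    have 1: "integral {x - h..x + h} (\<lambda>y. \<bar>F y - G y\<bar> powr r)
        \<le> 4 powr r * (M powr r + L powr r) * 2 * (h / N) powr r * h"
    proof -
      have Nl2: "real N * l = 2 * h" using Nl by simp
      have lr: "l powr r = 2 powr r * (h / N) powr r"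
        using \<open>0 < h\<close> by (simp add: l_def powr_mult flip: times_divide_eq_right)
      have four: "(4::real) powr r = 2 powr r * 2 powr r"
        by (simp flip: powr_mult)
      have "real N * (2 powr r * (M powr r + L powr r) * l powr r * l)
          = 2 powr r * (M powr r + L powr r) * l powr r * (real N * l)"
        by (simp only: ac_simps)
      also have "\<dots> = 4 powr r * (M powr r + L powr r) * 2 * (h / N) powr r * h"
        unfolding Nl2 lr four by (simp only: ac_simps)
      finally show ?thesis
        using pieces unfolding Nl by linarith
    qed
    have intG: "(\<lambda>y. \<bar>G y - G x - \<alpha> * (y - x)\<bar> powr r) integrable_on {x - h..x + h}"
      using \<open>1 \<le> r\<close> by (intro integrable_continuous_real continuous_on_powr' continuous_intros cont) auto
    have "integral {x - h..x + h} (\<lambda>y. \<bar>G y - G x - \<alpha> * (y - x)\<bar> powr r) \<le> (h / N) powr r * (x + h - (x - h))"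
    proof (rule integral_powr_le_of_bound)
      fix y assume "y \<in> {x - h..x + h}"
      then have y: "\<bar>y - x\<bar> \<le> h" by (auto simp: abs_le_iff)
      then have "1 / real N * \<bar>y - x\<bar> \<le> 1 / real N * h"
        by (intro mult_left_mono) auto
      then show "\<bar>G y - G x - \<alpha> * (y - x)\<bar> \<le> h / N"
        using d2'[of y] y h by simp
    qed (use \<open>1 \<le> r\<close> \<open>0 < h\<close> intG in auto)
    then have 2: "integral {x - h..x + h} (\<lambda>y. \<bar>G y - G x - \<alpha> * (y - x)\<bar> powr r) \<le> 2 * (h / N) powr r * h"
      by (simp add: algebra_simps)
    have eq: "(\<lambda>y. \<bar>(F y - G y) + (G y - G x - \<alpha> * (y - x))\<bar> powr r) = (\<lambda>y. \<bar>F y - F x - \<alpha> * (y - x)\<bar> powr r)"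
    proof -
      have "(F y - G y) + (G y - G x - \<alpha> * (y - x)) = F y - F x - \<alpha> * (y - x)" for y
        using FG[OF \<open>x \<in> S\<close>] by simp
      then show ?thesis by (simp only:)
    qed
    have intF: "(\<lambda>y. \<bar>F y - F x - \<alpha> * (y - x)\<bar> powr r) integrable_on {x - h..x + h}"
      using int[of "\<lambda>y. F x + \<alpha> * (y - x)"] by (simp add: continuous_intros diff_diff_eq)
    have "integral {x - h..x + h} (\<lambda>y. \<bar>F y - F x - \<alpha> * (y - x)\<bar> powr r)
      \<le> 2 powr r * (integral {x - h..x + h} (\<lambda>y. \<bar>F y - G y\<bar> powr r)
         + integral {x - h..x + h} (\<lambda>y. \<bar>G y - G x - \<alpha> * (y - x)\<bar> powr r))"
      using integral_abs_add_powr_le[of r "\<lambda>y. F y - G y" "\<lambda>y. G y - G x - \<alpha> * (y - x)" "{x - h..x + h}"]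
        \<open>1 \<le> r\<close> int[OF cont] intG intF unfolding eq by simp
    also have "\<dots> \<le> 2 powr r * (4 powr r * (M powr r + L powr r) * 2 * (h / N) powr r * h + 2 * (h / N) powr r * h)"
      using 1 2 by (intro mult_left_mono add_mono) auto
    also have "\<dots> = K * (h / N) powr r * h"
      by (simp add: K_def algebra_simps)
    finally show "integral {x - h..x + h} (\<lambda>y. \<bar>F y - F x - \<alpha> * (y - x)\<bar> powr r) \<le> K * (h / N) powr r * h" .
  qed
  ultimately show ?thesis by blast
qed

text \<open>The preceding estimate in terms of the definition: because \<open>r \<ge> 1\<close>, the constant \<open>K\<close> is at most
  \<open>(K + 1) powr r\<close>, so \<open>N \<ge> (K + 1) / e\<close> makes the \<open>r\<close>-th root in the definition at most \<open>e * h\<close>.\<close>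

lemma has_Lr_derivative_at_nonporous_point:
  assumes "1 \<le> r" and F: "in_Lr r a b F" and G: "\<And>x y. \<bar>G x - G y\<bar> \<le> L * \<bar>x - y\<bar>"
    and FG: "\<And>s. s \<in> S \<Longrightarrow> F s = G s" and "M \<ge> 0" "L \<ge> 0" "\<rho> > 0"
    and M: "\<And>s c d. \<lbrakk>s \<in> S; a \<le> c; c \<le> s; s \<le> d; d \<le> b; c < d; d - c < \<rho>\<rbrakk> \<Longrightarrow>
      integral {c..d} (\<lambda>y. \<bar>F y - F s\<bar> powr r) \<le> (M * (d - c)) powr r * (d - c)"
    and "a < x" "x < b" "x \<in> S" and por: "nonporous_at S x"
    and deriv: "(G has_real_derivative \<alpha>) (at x)"
  shows "has_Lr_derivative r F \<alpha> x"
  unfolding has_Lr_derivative_def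
proof (rule landau_o.smallI)
  fix e :: real assume "e > 0"
  define K where "K = 2 powr r * (4 powr r * (M powr r + L powr r) * 2 + 2)"
  have "K \<ge> 0" by (simp add: K_def)
  obtain N :: nat where N: "(K + 1) / e < real N"
    using reals_Archimedean2 by blast
  with \<open>K \<ge> 0\<close> \<open>e > 0\<close> have "N > 0"
    by (cases "N = 0") (auto simp: divide_less_0_iff)
  have KN: "(K + 1) / N \<le> e"
    using N \<open>N > 0\<close> \<open>e > 0\<close> by (simp add: field_simps)
  obtain \<delta> where "\<delta> > 0" and \<delta>: "\<And>h. 0 < h \<Longrightarrow> h < \<delta> \<Longrightarrow> {x - h..x + h} \<subseteq> {a..b} \<and>
    integral {x - h..x + h} (\<lambda>y. \<bar>F y - F x - \<alpha> * (y - x)\<bar> powr r) \<le> K * (h / N) powr r * h"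
    using Lr_approximation_at_nonporous_point[OF assms \<open>N > 0\<close>, folded K_def] by blast
  have "norm ((1 / h * (LINT t:{- h..h}|lebesgue. \<bar>F (x + t) - F x - \<alpha> * t\<bar> powr r)) powr (1 / r))
      \<le> e * norm h" if h: "0 < h" "h < \<delta>" for h
  proof -
    let ?f = "\<lambda>y. \<bar>F y - F x - \<alpha> * (y - x)\<bar> powr r"
    have "(\<lambda>y. \<bar>F y - (F x + \<alpha> * (y - x))\<bar> powr r) integrable_on {x - h..x + h}"
    proof (rule integrable_on_subinterval)
      show "(\<lambda>y. \<bar>F y - (F x + \<alpha> * (y - x))\<bar> powr r) integrable_on {a..b}"
        by (intro in_Lr_integrable_diff_continuous[OF \<open>1 \<le> r\<close> F] continuous_intros)
    qed (use \<delta>[OF h] in blast)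
    then have "(?f has_integral integral {x - h..x + h} ?f) {- h + x..h + x}"
      by (simp add: diff_diff_eq add.commute integrable_integral)
    then have "((\<lambda>t. \<bar>F (x + t) - F x - \<alpha> * t\<bar> powr r) has_integral integral {x - h..x + h} ?f) {- h..h}"
      by (subst (asm) has_integral_shift_Icc_real[symmetric]) (simp add: o_def)
    then have I: "(LINT t:{- h..h}|lebesgue. \<bar>F (x + t) - F x - \<alpha> * t\<bar> powr r) = integral {x - h..x + h} ?f"
      by (subst set_lebesgue_integral_nonneg_eq_integral) (auto simp: integral_unique integrable_on_def)
    have "1 / h * integral {x - h..x + h} ?f \<le> K * (h / N) powr r"
      using \<delta>[OF h] h by (simp add: pos_divide_le_eq)
    also have "K * (h / N) powr r \<le> (K + 1) powr r * (h / N) powr r"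
    proof (rule mult_right_mono)
      have "K + 1 \<le> (K + 1) powr r"
        using powr_mono[of 1 r "K + 1"] \<open>1 \<le> r\<close> \<open>K \<ge> 0\<close> by simp
      then show "K \<le> (K + 1) powr r" by simp
    qed simp
    also have "(K + 1) powr r * (h / N) powr r \<le> (e * h) powr r"
    proof -
      have "(K + 1) powr r * (h / N) powr r = ((K + 1) / N * h) powr r"
        using \<open>K \<ge> 0\<close> h by (simp flip: powr_mult)
      also have "\<dots> \<le> (e * h) powr r"
        using KN h \<open>K \<ge> 0\<close> \<open>1 \<le> r\<close> by (intro powr_mono2 mult_right_mono) auto
      finally show ?thesis .
    qed
    finally have *: "1 / h * (LINT t:{- h..h}|lebesgue. \<bar>F (x + t) - F x - \<alpha> * t\<bar> powr r) \<le> (e * h) powr r"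
      unfolding I .
    have "0 \<le> (LINT t:{- h..h}|lebesgue. \<bar>F (x + t) - F x - \<alpha> * t\<bar> powr r)"
      unfolding set_lebesgue_integral_def by (intro integral_nonneg_AE) auto
    then have "(1 / h * (LINT t:{- h..h}|lebesgue. \<bar>F (x + t) - F x - \<alpha> * t\<bar> powr r)) powr (1 / r)
        \<le> ((e * h) powr r) powr (1 / r)"
      using * h \<open>1 \<le> r\<close> by (intro powr_mono2) auto
    also have "\<dots> = e * h"
      using \<open>e > 0\<close> h \<open>1 \<le> r\<close> by (simp add: powr_powr)
    finally show ?thesis using h by simp
  qed
  then show "\<forall>\<^sub>F h in at_right 0. norm ((1 / h * (LINT t:{- h..h}|lebesgue.
      \<bar>F (x + t) - F x - \<alpha> * t\<bar> powr r)) powr (1 / r)) \<le> e * norm h"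
    using eventually_at_right_less[of 0] eventually_at_right_real[OF \<open>\<delta> > 0\<close>]
    by (auto elim: eventually_mono)
qed

section \<open>Boundedness of the quotients by a Vitali covering\<close>

text \<open>Apply the condition of \<open>AC_r\<close> with \<open>\<epsilon> = 1\<close>. Points at which the quotients are
  unbounded admit arbitrarily short intervals \<open>[c, d]\<close> for which the summand in that condition exceeds
  \<open>M * (d - c)\<close>. By Vitali's theorem, disjoint intervals of this kind cover almost all such points in a ball of
  diameter below \<open>\<eta>\<close>. Finitely many of them form an admissible partition, so their total
  length is at most \<open>1 / M\<close>. As \<open>M\<close> is arbitrary, these points form a null set.\<close>

lemma AC_r_difference_quotients_bounded:
  assumes "1 \<le> r" and F: "in_Lr r a b F" and AC: "AC_r r a b F E"
  shows "negligible {x \<in> E. \<forall>M>0. \<forall>\<rho>>0. \<exists>c d. a \<le> c \<and> c \<le> x \<and> x \<le> d \<and> d \<le> b \<and> c < d \<and> d - c < \<rho> \<and>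
    (M * (d - c)) powr r * (d - c) < integral {c..d} (\<lambda>y. \<bar>F y - F x\<bar> powr r)}" (is "negligible ?Z")
proof -
  from AC[unfolded AC_r_def, rule_format, OF zero_less_one]
  obtain \<eta> \<delta> where "\<eta> > 0" and \<delta>: "gauge_on E \<delta>" and
    small: "\<forall>P. partition_in a b P \<longrightarrow> fst ` P \<subseteq> E \<longrightarrow> (\<lambda>x. ball x (\<delta> x)) fine P \<longrightarrow>
      (\<Sum>(x, K)\<in>P. measure lebesgue K) < \<eta> \<longrightarrow>
      (\<Sum>(x, K)\<in>P. ((1 / measure lebesgue K) *
        (LINT y:K|lebesgue. \<bar>F y - F x\<bar> powr r)) powr (1 / r)) < 1"
    by (elim exE conjE) (rule that)
  have "\<exists>U. openin (top_of_set ?Z) U \<and> z \<in> U \<and> negligible U" if "z \<in> ?Z" for z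
  proof (intro exI conjI)
    let ?U = "?Z \<inter> ball z (\<eta> / 4)"
    show "openin (top_of_set ?Z) ?U" "z \<in> ?U"
      using that \<open>\<eta> > 0\<close> by (auto intro: openin_open_Int)
    show "negligible ?U"
      unfolding negligible_outer_le
    proof (intro allI impI)
      fix e :: real assume "e > 0"
      \<comment> \<open>The slope is \<open>M = 1 / e\<close>. The third component is the tag; it is remembered since it need
        not be the midpoint of the interval.\<close>
      define \<K> where "\<K> = {(c, d, x). x \<in> ?U \<and> a \<le> c \<and> c \<le> x \<and> x \<le> d \<and> d \<le> b \<and> c < d \<and>
        {c..d} \<subseteq> ball z (\<eta> / 4) \<and> d - c < \<delta> x \<and>
        (1 / e * (d - c)) powr r * (d - c) < integral {c..d} (\<lambda>y. \<bar>F y - F x\<bar> powr r)}"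
      define I where "I = (\<lambda>(c::real, d::real, x::real). {c..d})"
      let ?m = "\<lambda>(c, d, x::real). (c + d) / 2 :: real" and ?\<rho> = "\<lambda>(c, d, x::real). (d - c) / 2 :: real"
      have cball: "cball (?m i) (?\<rho> i) = I i" for i
        by (cases i) (simp add: I_def cball_eq_atLeastAtMost field_simps)
      obtain C where "countable C" "C \<subseteq> \<K>" and disj: "pairwise (\<lambda>i j. disjnt (I i) (I j)) C"
        and rest: "negligible (?U - (\<Union>i\<in>C. I i))"
      proof (rule Vitali_covering_theorem_cballs[of \<K> ?\<rho> ?U ?m, unfolded cball])
        show "0 < ?\<rho> i" if "i \<in> \<K>" for i
          using that by (auto simp: \<K>_def)
        fix x \<rho> :: real assume x: "x \<in> ?U" and "\<rho> > 0"
        then obtain \<tau> where "\<tau> > 0" and \<tau>: "ball x \<tau> \<subseteq> ball z (\<eta> / 4)"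
          by (meson IntD2 open_ball openE)
        have "\<delta> x > 0" using \<delta> x by (auto simp: gauge_on_def)
        then have "min \<rho> (min \<tau> (\<delta> x)) > 0" using \<open>\<rho> > 0\<close> \<open>\<tau> > 0\<close> by simp
        then obtain c d where cd: "a \<le> c" "c \<le> x" "x \<le> d" "d \<le> b" "c < d" "d - c < min \<rho> (min \<tau> (\<delta> x))"
          "(1 / e * (d - c)) powr r * (d - c) < integral {c..d} (\<lambda>y. \<bar>F y - F x\<bar> powr r)"
          using spec[OF conjunct2[OF CollectD[OF IntD1[OF x]]], of "1 / e"] \<open>e > 0\<close>
          by (metis zero_less_divide_1_iff)
        have "{c..d} \<subseteq> ball x \<tau>" using cd by (auto simp: dist_real_def)
        then have "(c, d, x) \<in> \<K>" using cd x \<tau> unfolding \<K>_def by (simp add: subset_trans[OF _ \<tau>])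
        then show "\<exists>i. i \<in> \<K> \<and> x \<in> I i \<and> ?\<rho> i < \<rho>"
          using cd by (intro exI[of _ "(c, d, x)"]) (auto simp: I_def)
      qed
      have finite_bound: "measure lebesgue (\<Union>i\<in>D. I i) \<le> e" if "D \<subseteq> C" "finite D" for D
      proof -
        have DK: "D \<subseteq> \<K>" using that \<open>C \<subseteq> \<K>\<close> by blast
        have disjD: "I i \<inter> I j = {}" if "i \<in> D" "j \<in> D" "i \<noteq> j" for i j
          using disj that \<open>D \<subseteq> C\<close> by (auto simp: pairwise_def disjnt_def)
        let ?tag = "\<lambda>(c::real, d::real, x::real). x"
        define P where "P = (\<lambda>i. (?tag i, I i)) ` D"
        have inj: "inj_on (\<lambda>i. (?tag i, I i)) D"
        proof (rule inj_onI)
          fix i j assume ij: "i \<in> D" "j \<in> D" "(?tag i, I i) = (?tag j, I j)"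
          moreover have "I i \<noteq> {}" using DK ij(1) by (auto simp: \<K>_def I_def)
          ultimately show "i = j" using disjD[of i j] by auto
        qed
        have "P tagged_partial_division_of {a..b}"
          unfolding tagged_partial_division_of_def
        proof (intro conjI allI impI)
          show "finite P" using \<open>finite D\<close> by (simp add: P_def)
          show "x \<in> K" "K \<subseteq> {a..b}" "\<exists>a b. K = cbox a b" if "(x, K) \<in> P" for x K
            using that DK by (force simp: P_def \<K>_def I_def)+
          show "interior K1 \<inter> interior K2 = {}"
            if "(x1, K1) \<in> P \<and> (x2, K2) \<in> P \<and> (x1, K1) \<noteq> (x2, K2)" for x1 K1 x2 K2
          proof -
            obtain i j where ij: "i \<in> D" "j \<in> D" "(x1, K1) = (?tag i, I i)" "(x2, K2) = (?tag j, I j)"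
              using \<open>(x1, K1) \<in> P \<and> (x2, K2) \<in> P \<and> (x1, K1) \<noteq> (x2, K2)\<close>
              unfolding P_def by blast
            then have "i \<noteq> j"
              using \<open>(x1, K1) \<in> P \<and> (x2, K2) \<in> P \<and> (x1, K1) \<noteq> (x2, K2)\<close> by metis
            then show ?thesis
              using disjD[OF ij(1,2)] ij interior_subset[of K1] interior_subset[of K2] by blast
          qed
        qed
        then have part: "partition_in a b P"
          using DK by (auto simp: partition_in_def P_def \<K>_def I_def)
        have tags: "fst ` P \<subseteq> E"
          using DK by (auto simp: P_def \<K>_def)
        have fine: "(\<lambda>x. ball x (\<delta> x)) fine P"
          using DK by (force simp: fine_def P_def \<K>_def I_def dist_real_def)
        have meas: "measure lebesgue (\<Union>i\<in>D. I i) = (\<Sum>i\<in>D. measure lebesgue (I i))"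
          using \<open>finite D\<close> disjD by (intro measure_UNION') (auto simp: I_def pairwise_def disjnt_def)
        have "measure lebesgue (\<Union>i\<in>D. I i) \<le> measure lebesgue (ball z (\<eta> / 4))"
          using DK \<open>finite D\<close> by (intro measure_mono_fmeasurable) (auto simp: \<K>_def I_def)
        also have "\<dots> < \<eta>"
          using \<open>\<eta> > 0\<close> by (simp add: ball_eq_greaterThanLessThan)
        finally have "(\<Sum>i\<in>D. measure lebesgue (I i)) < \<eta>"
          unfolding meas .
        then have total: "(\<Sum>(x, K)\<in>P. measure lebesgue K) < \<eta>"
          unfolding P_def by (subst sum.reindex[OF inj]) (simp add: o_def)
        have "(\<Sum>i\<in>D. 1 / e * measure lebesgue (I i)) \<le>
            (\<Sum>i\<in>D. ((1 / measure lebesgue (I i)) *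
                (LINT y:I i|lebesgue. \<bar>F y - F (?tag i)\<bar> powr r)) powr (1 / r))"
        proof (rule sum_mono)
          fix i assume "i \<in> D"
          obtain c d x where i: "i = (c, d, x)" by (cases i)
          then have cdx: "a \<le> c" "c < d" "d \<le> b"
            "(1 / e * (d - c)) powr r * (d - c) < integral {c..d} (\<lambda>y. \<bar>F y - F x\<bar> powr r)"
            using \<open>i \<in> D\<close> DK by (auto simp: \<K>_def)
          have "(\<lambda>y. \<bar>F y - F x\<bar> powr r) integrable_on {c..d}"
            using in_Lr_integrable_diff_continuous[OF \<open>1 \<le> r\<close> F, of "\<lambda>_. F x"] cdx
            by (auto intro: integrable_on_subinterval)
          then have "(LINT y:{c..d}|lebesgue. \<bar>F y - F x\<bar> powr r) = integral {c..d} (\<lambda>y. \<bar>F y - F x\<bar> powr r)"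
            by (rule set_lebesgue_integral_nonneg_eq_integral) simp
          then have "(1 / e * (d - c)) powr r \<le> 1 / (d - c) * (LINT y:{c..d}|lebesgue. \<bar>F y - F x\<bar> powr r)"
            using cdx by (simp add: pos_le_divide_eq)
          then have "((1 / e * (d - c)) powr r) powr (1 / r)
              \<le> (1 / (d - c) * (LINT y:{c..d}|lebesgue. \<bar>F y - F x\<bar> powr r)) powr (1 / r)"
            using \<open>1 \<le> r\<close> by (intro powr_mono2) auto
          moreover have "((1 / e * (d - c)) powr r) powr (1 / r) = 1 / e * (d - c)"
            using \<open>1 \<le> r\<close> \<open>e > 0\<close> cdx by (simp add: powr_powr)
          ultimately show "1 / e * measure lebesgue (I i) \<le> ((1 / measure lebesgue (I i)) *
                (LINT y:I i|lebesgue. \<bar>F y - F (?tag i)\<bar> powr r)) powr (1 / r)"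
            using cdx by (simp add: i I_def)
        qed
        also have "\<dots> = (\<Sum>(x, K)\<in>P. ((1 / measure lebesgue K) *
                (LINT y:K|lebesgue. \<bar>F y - F x\<bar> powr r)) powr (1 / r))"
          unfolding P_def by (subst sum.reindex[OF inj]) (simp add: o_def)
        also have "\<dots> < 1"
          by (rule small[rule_format, OF part tags fine total])
        finally show ?thesis
          using \<open>e > 0\<close> by (simp add: meas pos_divide_less_eq flip: sum_divide_distrib)
      qed
      let ?T = "\<Union>i\<in>C. I i"
      have I: "I i \<in> lmeasurable" for i
        by (cases i) (simp add: I_def)
      have T: "?T \<in> lmeasurable" "measure lebesgue ?T \<le> e"
        using fmeasurable_UN_bound[OF \<open>countable C\<close> I finite_bound] measure_UN_bound[OF \<open>countable C\<close> I finite_bound]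
        by auto
      have N: "?U - ?T \<in> lmeasurable" "measure lebesgue (?U - ?T) = 0"
        using rest by (auto simp: negligible_iff_measure)
      show "\<exists>T. ?U \<subseteq> T \<and> T \<in> lmeasurable \<and> measure lebesgue T \<le> e"
      proof (intro exI conjI)
        show "?U \<subseteq> ?T \<union> (?U - ?T)" by blast
        show "?T \<union> (?U - ?T) \<in> lmeasurable" by (rule fmeasurable.Un[OF T(1) N(1)])
        show "measure lebesgue (?T \<union> (?U - ?T)) \<le> e"
          using measure_Un_le[of ?T lebesgue "?U - ?T"] T N by (simp add: fmeasurableD)
      qed
    qed
  qed
  then show ?thesis
    by (intro locally_negligible_alt[THEN iffD2] ballI)
qed

section \<open>Almost everywhere differentiability in the mean\<close>

text \<open>Compare \<open>F x\<close> and \<open>F y\<close> through the values \<open>F t\<close> for \<open>t\<close> between them: integrating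
  \<open>|F x - F y| powr r\<close> over \<open>[x, y]\<close> involves only the two mean deviations that are assumed small.\<close>

lemma lipschitz_of_Lr_difference_quotients:
  assumes "1 \<le> r" and F: "in_Lr r a b F" and "M \<ge> 0" and "a \<le> x" "x < y" "y \<le> b"
    and x: "integral {x..y} (\<lambda>t. \<bar>F t - F x\<bar> powr r) \<le> (M * (y - x)) powr r * (y - x)"
    and y: "integral {x..y} (\<lambda>t. \<bar>F t - F y\<bar> powr r) \<le> (M * (y - x)) powr r * (y - x)"
  shows "\<bar>F x - F y\<bar> \<le> 4 * M * (y - x)"
proof -
  define A where "A = M * (y - x)"
  have "A \<ge> 0" using \<open>M \<ge> 0\<close> \<open>x < y\<close> by (simp add: A_def)
  have int: "(\<lambda>t. \<bar>F t - c\<bar> powr r) integrable_on {x..y}" for c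
    using in_Lr_integrable_diff_continuous[OF \<open>1 \<le> r\<close> F, of "\<lambda>_. c"] assms
    by (auto intro: integrable_on_subinterval)
  have int': "(\<lambda>t. \<bar>F x - F t\<bar> powr r) integrable_on {x..y}"
    using int[of "F x"] by (simp add: abs_minus_commute)
  have "integral {x..y} (\<lambda>t. \<bar>F x - F y\<bar> powr r)
    \<le> 2 powr r * (integral {x..y} (\<lambda>t. \<bar>F x - F t\<bar> powr r) + integral {x..y} (\<lambda>t. \<bar>F t - F y\<bar> powr r))"
    using integral_abs_add_powr_le[of r "\<lambda>t. F x - F t" "\<lambda>t. F t - F y" "{x..y}"] int' int \<open>1 \<le> r\<close>
      integrable_const_ivl[of "\<bar>F x - F y\<bar> powr r" x y]
    by simp
  also have "\<dots> \<le> 2 powr r * (A powr r * (y - x) + A powr r * (y - x))"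
    using x y unfolding A_def by (intro mult_left_mono add_mono) (simp_all add: abs_minus_commute)
  finally have "\<bar>F x - F y\<bar> powr r * (y - x) \<le> (2 * 2 powr r * A powr r) * (y - x)"
    using \<open>x < y\<close> by (simp add: algebra_simps)
  then have "\<bar>F x - F y\<bar> powr r \<le> 2 * 2 powr r * A powr r"
    using \<open>x < y\<close> by simp
  also have "\<dots> \<le> 2 powr r * 2 powr r * A powr r"
    using powr_mono[of 1 r "2::real"] \<open>1 \<le> r\<close> by (intro mult_right_mono) auto
  also have "\<dots> = (4 * A) powr r"
    using \<open>A \<ge> 0\<close> by (simp flip: powr_mult)
  finally have "\<bar>F x - F y\<bar> powr r \<le> (4 * A) powr r" .
  then have "\<bar>F x - F y\<bar> \<le> 4 * A"
    using \<open>1 \<le> r\<close> \<open>A \<ge> 0\<close> powr_less_mono2[of r "4 * A" "\<bar>F x - F y\<bar>"] by linarith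
  then show ?thesis by (simp add: A_def)
qed

text \<open>A uniform bound on the quotients makes \<open>F\<close> Lipschitz on every part \<open>S\<close> of \<open>B\<close> of diameter below \<open>\<rho>\<close>.
  Its Lipschitz extension \<open>G\<close> is differentiable almost everywhere, and the derivative of \<open>G\<close> is an
  \<open>L\<^sup>r\<close>-derivative of \<open>F\<close> at the points where \<open>S\<close> is nonporous. It suffices to treat small parts because being
  negligible is a local property.\<close>

lemma Lr_differentiable_AE_on_bounded_quotients:
  assumes "1 \<le> r" and F: "in_Lr r a b F" and "M > 0" "\<rho> > 0"
    and M: "\<And>s c d. \<lbrakk>s \<in> B; a \<le> c; c \<le> s; s \<le> d; d \<le> b; c < d; d - c < \<rho>\<rbrakk> \<Longrightarrow>
      integral {c..d} (\<lambda>y. \<bar>F y - F s\<bar> powr r) \<le> (M * (d - c)) powr r * (d - c)"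
    and "B \<subseteq> {a..b}"
  shows "negligible {x \<in> B. \<not> Lr_differentiable r F x}" (is "negligible ?W")
proof -
  have "\<exists>U. openin (top_of_set ?W) U \<and> z \<in> U \<and> negligible U" if "z \<in> ?W" for z
  proof (intro exI conjI)
    let ?U = "?W \<inter> ball z (\<rho> / 2)"
    show "openin (top_of_set ?W) ?U" "z \<in> ?U"
      using that \<open>\<rho> > 0\<close> by (auto intro: openin_open_Int)
    define S where "S = B \<inter> ball z (\<rho> / 2)"
    have lip_less: "\<bar>F x - F y\<bar> \<le> (4 * M) * (y - x)" if "x \<in> S" "y \<in> S" "x < y" for x y
    proof (rule lipschitz_of_Lr_difference_quotients[OF \<open>1 \<le> r\<close> F])
      have "\<bar>z - x\<bar> < \<rho> / 2" "\<bar>z - y\<bar> < \<rho> / 2"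
        using that by (simp_all add: S_def dist_real_def)
      then have "y - x < \<rho>" by linarith
      moreover have "a \<le> x" "y \<le> b" "x \<in> B" "y \<in> B"
        using that \<open>B \<subseteq> {a..b}\<close> by (auto simp: S_def)
      ultimately show "a \<le> x" "y \<le> b"
        "integral {x..y} (\<lambda>t. \<bar>F t - F x\<bar> powr r) \<le> (M * (y - x)) powr r * (y - x)"
        "integral {x..y} (\<lambda>t. \<bar>F t - F y\<bar> powr r) \<le> (M * (y - x)) powr r * (y - x)"
        using M[of x x y] M[of y x y] \<open>x < y\<close> by auto
    qed (use that \<open>M > 0\<close> in auto)
    have lip: "\<bar>F x - F y\<bar> \<le> (4 * M) * \<bar>x - y\<bar>" if "x \<in> S" "y \<in> S" for x y
      using lip_less[OF that] lip_less[OF that(2,1)] by (cases x y rule: linorder_cases) (auto simp: abs_minus_commute)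
    have "S \<noteq> {}" using \<open>z \<in> ?U\<close> by (auto simp: S_def)
    then obtain G where G: "\<And>x y. \<bar>G x - G y\<bar> \<le> (4 * M) * \<bar>x - y\<bar>" and GF: "\<And>x. x \<in> S \<Longrightarrow> G x = F x"
      using lipschitz_extension[of S F "4 * M"] lip \<open>M > 0\<close> by auto
    \<comment> \<open>The endpoints are left out because the intervals \<open>[x - h, x + h]\<close> must lie in \<open>[a, b]\<close>.\<close>
    have "Lr_differentiable r F x"
      if "x \<in> S" "x \<noteq> a" "x \<noteq> b" "nonporous_at S x" "(G has_real_derivative D) (at x)" for x D
    proof -
      have "has_Lr_derivative r F D x"
      proof (rule has_Lr_derivative_at_nonporous_point[OF \<open>1 \<le> r\<close> F G])
        show "F s = G s" if "s \<in> S" for s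
          using GF[OF that] by simp
        show "integral {c..d} (\<lambda>y. \<bar>F y - F s\<bar> powr r) \<le> (M * (d - c)) powr r * (d - c)"
          if "s \<in> S" "a \<le> c" "c \<le> s" "s \<le> d" "d \<le> b" "c < d" "d - c < \<rho>" for s c d
          using M[of s c d] that by (simp add: S_def)
        have "x \<in> {a..b}" using \<open>x \<in> S\<close> \<open>B \<subseteq> {a..b}\<close> by (auto simp: S_def)
        then show "a < x" "x < b" using \<open>x \<noteq> a\<close> \<open>x \<noteq> b\<close> by auto
      qed (use that \<open>M > 0\<close> \<open>\<rho> > 0\<close> in auto)
      then show ?thesis by (auto simp: Lr_differentiable_def)
    qed
    then have "?U \<subseteq> {a, b} \<union> {x \<in> S. \<not> nonporous_at S x} \<union> {x. \<nexists>D. (G has_real_derivative D) (at x)}"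
      by (auto simp: S_def)
    moreover have "negligible ({a, b} \<union> {x \<in> S. \<not> nonporous_at S x} \<union> {x. \<nexists>D. (G has_real_derivative D) (at x)})"
      by (intro negligible_Un negligible_porous_points lipschitz_AE_differentiable[OF G]) auto
    ultimately show "negligible ?U"
      by (rule negligible_subset[rotated])
  qed
  then show ?thesis
    by (intro locally_negligible_alt[THEN iffD2] ballI)
qed

theorem theorem12:
  fixes r a b :: real and F :: "real \<Rightarrow> real"
  assumes "1 \<le> r" and "a < b"
    and "in_Lr r a b F"
    and "ACG_r r a b F"
  shows "AE x in lebesgue. x \<in> {a..b} \<longrightarrow> Lr_differentiable r F x"
proof -
  obtain E :: "nat \<Rightarrow> real set" where E: "{a..b} = (\<Union>n. E n)" "\<And>n. AC_r r a b F (E n)"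
    using \<open>ACG_r r a b F\<close> by (auto simp: ACG_r_def)
  define Q where "Q M \<rho> x \<longleftrightarrow> (\<forall>c d. a \<le> c \<and> c \<le> x \<and> x \<le> d \<and> d \<le> b \<and> c < d \<and> d - c < \<rho> \<longrightarrow>
    integral {c..d} (\<lambda>y. \<bar>F y - F x\<bar> powr r) \<le> (M * (d - c)) powr r * (d - c))" for M \<rho> x
  let ?Z = "\<lambda>n. {x \<in> E n. \<forall>M>0. \<forall>\<rho>>0. \<not> Q M \<rho> x}"
  \<comment> \<open>The bound \<open>k + 1\<close> for intervals shorter than \<open>1 / (k + 1)\<close> weakens as \<open>k\<close> grows, so these
    countably many cases exhaust the points with bounded quotients.\<close>
  let ?W = "\<lambda>k::nat. {x \<in> {x \<in> {a..b}. Q (real (Suc k)) (1 / real (Suc k)) x}. \<not> Lr_differentiable r F x}"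
  have "negligible (?Z n)" for n
    using AC_r_difference_quotients_bounded[OF assms(1,3) E(2)[of n]]
    by (simp add: Q_def not_le conj_ac cong: conj_cong)
  then have Z: "negligible (\<Union>n. ?Z n)" by (rule negligible_Union_nat)
  have "negligible (?W k)" for k
    by (rule Lr_differentiable_AE_on_bounded_quotients[OF assms(1,3), of "real (Suc k)" "1 / real (Suc k)"])
       (auto simp: Q_def)
  then have W: "negligible (\<Union>k. ?W k)" by (rule negligible_Union_nat)
  have mono: "Q M' \<rho>' x" if "Q M \<rho> x" "0 < M" "M \<le> M'" "\<rho>' \<le> \<rho>" for M M' \<rho> \<rho>' x
    unfolding Q_def
  proof (intro allI impI)
    fix c d assume cd: "a \<le> c \<and> c \<le> x \<and> x \<le> d \<and> d \<le> b \<and> c < d \<and> d - c < \<rho>'"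
    then have "integral {c..d} (\<lambda>y. \<bar>F y - F x\<bar> powr r) \<le> (M * (d - c)) powr r * (d - c)"
      using that unfolding Q_def by auto
    also have "\<dots> \<le> (M' * (d - c)) powr r * (d - c)"
      using that cd \<open>1 \<le> r\<close> by (intro mult_right_mono powr_mono2) auto
    finally show "integral {c..d} (\<lambda>y. \<bar>F y - F x\<bar> powr r) \<le> (M' * (d - c)) powr r * (d - c)" .
  qed
  have "{x \<in> {a..b}. \<not> Lr_differentiable r F x} \<subseteq> (\<Union>n. ?Z n) \<union> (\<Union>k. ?W k)"
  proof
    fix x assume x: "x \<in> {x \<in> {a..b}. \<not> Lr_differentiable r F x}"
    show "x \<in> (\<Union>n. ?Z n) \<union> (\<Union>k. ?W k)"
    proof (cases "\<exists>M>0. \<exists>\<rho>>0. Q M \<rho> x")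
      case True
      then obtain M \<rho> where "M > 0" "\<rho> > 0" "Q M \<rho> x" by blast
      obtain k :: nat where "max M (1 / \<rho>) < real k"
        using reals_Archimedean2 by blast
      then have "M \<le> real (Suc k)" "1 / real (Suc k) \<le> \<rho>"
        using \<open>\<rho> > 0\<close> by (auto simp: field_simps)
      then have "Q (real (Suc k)) (1 / real (Suc k)) x"
        using mono[OF \<open>Q M \<rho> x\<close> \<open>M > 0\<close>] by blast
      then show ?thesis using x by blast
    next
      case False
      moreover obtain n where "x \<in> E n" using x E(1) by blast
      ultimately show ?thesis by blast
    qed
  qed
  then have "negligible {x \<in> {a..b}. \<not> Lr_differentiable r F x}"
    using negligible_subset[OF negligible_Un[OF Z W]] by blast
  then show ?thesis
    by (intro AE_I'[of "{x \<in> {a..b}. \<not> Lr_differentiable r F x}"]) (auto simp: negligible_iff_null_sets)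
qed

end
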